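(* For every BF-MWSAT instance with a continuous t-norm and costs $c\ge0$, for every search node $p$ with all current domains $D_j(p)$ ($j\in\mathcal{J}$) nonempty, and for every disjoint-witness packing $K$ at $p$, the number $$\mathrm{LB}_K(p)=\sum_{j=1}^n c_j\min D_j(p)+\sum_{i\in K}\delta_i(p)$$ is a lower bound on the objective value $c^Tx$ of every feasible completion $x$ of $p$.
   Context: A t-norm is a commutative, associative map $\varphi:[0,1]^2\to[0,1]$, non-decreasing in each argument, with $\varphi(1,z)=z$. BF-MWSAT: let $\mathcal{I}=\{1,\dots,m\}$ (rows) and $\mathcal{J}=\{1,\dots,n\}$ (variables). Given $A^\pm=(a^\pm_{ij})\in[0,1]^{m\times n}$, $b\in[0,1]^m$, a continuous t-norm $\varphi$ and $c\in\mathbb{R}_{\ge0}^n$, minimize $c^Tx$ over $x\in[0,1]^n$ subject to $\max_{j\in\mathcal{J}}q_{ij}(x_j)=b_i$ for all $i\in\mathcal{I}$, where $q_{ij}(z)=\max\{\varphi(a^+_{ij},z),\varphi(a^-_{ij},1-z)\}$. Scalar sets: $I_{ij}=\{z\in[0,1]:q_{ij}(z)\le b_i\}$, $S_{ij}=\{z\in[0,1]:q_{ij}(z)=b_i\}$, $I_j=\bigcap_{i\in\mathcal{I}}I_{ij}$, $S'_{ij}=S_{ij}\cap I_j$, $J_i=\{j\in\mathcal{J}:S'_{ij}\ne\varnothing\}$. These sets are compact, so minima of nonempty finite intersections of them exist. Complete witness assignments: $e:\mathcal{I}\to\mathcal{J}$ with $e(i)\in J_i$ for all $i$. Put $D_j(e)=I_j$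 if no row is assigned to $j$, and $D_j(e)=\bigcap_{i:\,e(i)=j}S'_{ij}$ otherwise. The assignment $e$ is compatible if all $D_j(e)\ne\varnothing$, and then $D(e)=D_1(e)\times\cdots\times D_n(e)$. Nodes: let $\mathcal{A}\subseteq\mathcal{I}$ be the set of active rows (the rows remaining after exact preprocessing; the sets $I_j$, $S'_{ij}$ are always those of the original instance). A search node is a partial witness assignment $p:R(p)\to\mathcal{J}$ with $R(p)\subseteq\mathcal{A}$ and $p(i)\in J_i$. Its domains are $D_j(p)=I_j\cap\bigcap_{i\in R(p),\,p(i)=j}S'_{ij}$. For $i\in\mathcal{A}\setminus R(p)$, $J_i(p)=\{j\in J_i:D_j(p)\cap S'_{ij}\ne\varnothing\}$ and $$\delta_i(p)=\min_{j\in J_i(p)}c_j\bigl[\min(D_j(p)\cap S'_{ij})-\min D_j(p)\bigr],$$ with $\delta_i(p)=+\infty$ if $J_i(p)=\varnothing$. A disjoint-witness packing at $p$ is a set $K\subseteq\mathcal{A}\setminus R(p)$ with $J_r(p)\cap J_i(p)=\varnothing$ for all distinct $r,i\in K$. A feasible completion of $p$ is a vector $x\in D(e)$ for some compatible complete witness assignment $e$ extending $p$ (i.e. $e(i)=p(i)$ for $i\in R(p)$). *)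

theory Defs
  imports "HOL-Analysis.Analysis" "HOL-Library.Disjoint_Sets"
begin

definition t_norm :: "(real \<Rightarrow> real \<Rightarrow> real) \<Rightarrow> bool" where
  "t_norm \<phi> \<longleftrightarrow>
     (\<forall>x\<in>{0..1}. \<forall>y\<in>{0..1}. \<phi> x y \<in> {0..1}) \<and>
     (\<forall>x\<in>{0..1}. \<forall>y\<in>{0..1}. \<phi> x y = \<phi> y x) \<and>
     (\<forall>x\<in>{0..1}. \<forall>y\<in>{0..1}. \<forall>z\<in>{0..1}. \<phi> (\<phi> x y) z = \<phi> x (\<phi> y z)) \<and>
     (\<forall>x\<in>{0..1}. mono_on {0..1} (\<lambda>y. \<phi> x y)) \<and>
     (\<forall>y\<in>{0..1}. mono_on {0..1} (\<lambda>x. \<phi> x y)) \<and>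
     (\<forall>z\<in>{0..1}. \<phi> 1 z = z)"

definition continuous_t_norm :: "(real \<Rightarrow> real \<Rightarrow> real) \<Rightarrow> bool" where
  "continuous_t_norm \<phi> \<longleftrightarrow>
     t_norm \<phi> \<and> continuous_on ({0..1} \<times> {0..1}) (\<lambda>(x, y). \<phi> x y)"

text \<open>
  Matrices and vectors are functions on indices counted from 1; their values outside
  the index ranges \<open>{1..m}\<close> and \<open>{1..n}\<close> are irrelevant.
\<close>

record bf_mwsat =
  num_rows :: nat
  num_vars :: nat
  a_pos :: "nat \<Rightarrow> nat \<Rightarrow> real"
  a_neg :: "nat \<Rightarrow> nat \<Rightarrow> real"
  rhs :: "nat \<Rightarrow> real"
  tnorm :: "real \<Rightarrow> real \<Rightarrow> real"
  cost :: "nat \<Rightarrow> real"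

definition row_set :: "bf_mwsat \<Rightarrow> nat set" where
  "row_set P = {1..num_rows P}"

definition var_set :: "bf_mwsat \<Rightarrow> nat set" where
  "var_set P = {1..num_vars P}"

definition is_bf_mwsat :: "bf_mwsat \<Rightarrow> bool" where
  "is_bf_mwsat P \<longleftrightarrow>
     continuous_t_norm (tnorm P) \<and>
     (\<forall>i\<in>row_set P. \<forall>j\<in>var_set P. a_pos P i j \<in> {0..1} \<and> a_neg P i j \<in> {0..1}) \<and>
     (\<forall>i\<in>row_set P. rhs P i \<in> {0..1}) \<and>
     (\<forall>j\<in>var_set P. 0 \<le> cost P j)"

definition objective :: "bf_mwsat \<Rightarrow> (nat \<Rightarrow> real) \<Rightarrow> real" where
  "objective P x = (\<Sum>j\<in>var_set P. cost P j * x j)"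

definition q :: "bf_mwsat \<Rightarrow> nat \<Rightarrow> nat \<Rightarrow> real \<Rightarrow> real" where
  "q P i j z = max (tnorm P (a_pos P i j) z) (tnorm P (a_neg P i j) (1 - z))"

definition I_cell :: "bf_mwsat \<Rightarrow> nat \<Rightarrow> nat \<Rightarrow> real set" where
  "I_cell P i j = {z\<in>{0..1}. q P i j z \<le> rhs P i}"

definition S_cell :: "bf_mwsat \<Rightarrow> nat \<Rightarrow> nat \<Rightarrow> real set" where
  "S_cell P i j = {z\<in>{0..1}. q P i j z = rhs P i}"

text \<open>
  The intersection is taken inside the unit interval, which matters only for an
  instance without rows.
\<close>

definition I_var :: "bf_mwsat \<Rightarrow> nat \<Rightarrow> real set" where
  "I_var P j = {0..1} \<inter> (\<Inter>i\<in>row_set P. I_cell P i j)"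

definition S'_cell :: "bf_mwsat \<Rightarrow> nat \<Rightarrow> nat \<Rightarrow> real set" where
  "S'_cell P i j = S_cell P i j \<inter> I_var P j"

definition witnesses :: "bf_mwsat \<Rightarrow> nat \<Rightarrow> nat set" where
  "witnesses P i = {j\<in>var_set P. S'_cell P i j \<noteq> {}}"

definition complete_assignment :: "bf_mwsat \<Rightarrow> (nat \<Rightarrow> nat) \<Rightarrow> bool" where
  "complete_assignment P e \<longleftrightarrow> (\<forall>i\<in>row_set P. e i \<in> witnesses P i)"

definition complete_domain :: "bf_mwsat \<Rightarrow> (nat \<Rightarrow> nat) \<Rightarrow> nat \<Rightarrow> real set" where
  "complete_domain P e j =
     (if \<forall>i\<in>row_set P. e i \<noteq> j then I_var P j
      else (\<Inter>i\<in>{i\<in>row_set P. e i = j}. S'_cell P i j))"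

definition compatible :: "bf_mwsat \<Rightarrow> (nat \<Rightarrow> nat) \<Rightarrow> bool" where
  "compatible P e \<longleftrightarrow> (\<forall>j\<in>var_set P. complete_domain P e j \<noteq> {})"

definition complete_box :: "bf_mwsat \<Rightarrow> (nat \<Rightarrow> nat) \<Rightarrow> (nat \<Rightarrow> real) set" where
  "complete_box P e = (\<Pi>\<^sub>E j\<in>var_set P. complete_domain P e j)"

text \<open>A partial assignment \<open>p\<close> is a map; its set of assigned rows \<open>R(p)\<close> is \<open>dom p\<close>.\<close>

definition search_node :: "bf_mwsat \<Rightarrow> nat set \<Rightarrow> (nat \<rightharpoonup> nat) \<Rightarrow> bool" where
  "search_node P A p \<longleftrightarrow> dom p \<subseteq> A \<and> (\<forall>i\<in>dom p. the (p i) \<in> witnesses P i)"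

definition node_domain :: "bf_mwsat \<Rightarrow> (nat \<rightharpoonup> nat) \<Rightarrow> nat \<Rightarrow> real set" where
  "node_domain P p j = I_var P j \<inter> (\<Inter>i\<in>{i. p i = Some j}. S'_cell P i j)"

definition node_witnesses :: "bf_mwsat \<Rightarrow> (nat \<rightharpoonup> nat) \<Rightarrow> nat \<Rightarrow> nat set" where
  "node_witnesses P p i = {j\<in>witnesses P i. node_domain P p j \<inter> S'_cell P i j \<noteq> {}}"

text \<open>
  The smallest element of a possibly infinite set of reals (\<open>Min\<close> is only meaningful
  for finite sets). It is applied to nonempty compact sets, where it exists.
\<close>

definition min_elem :: "real set \<Rightarrow> real" where
  "min_elem S = (LEAST z. z \<in> S)"

definition delta :: "bf_mwsat \<Rightarrow> (nat \<rightharpoonup> nat) \<Rightarrow> nat \<Rightarrow> ereal" where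
  "delta P p i =
     (if node_witnesses P p i = {} then \<infinity>
      else ereal (Min ((\<lambda>j. cost P j *
             (min_elem (node_domain P p j \<inter> S'_cell P i j) - min_elem (node_domain P p j)))
           ` node_witnesses P p i)))"

definition disjoint_witness_packing ::
    "bf_mwsat \<Rightarrow> nat set \<Rightarrow> (nat \<rightharpoonup> nat) \<Rightarrow> nat set \<Rightarrow> bool" where
  "disjoint_witness_packing P A p K \<longleftrightarrow>
     K \<subseteq> A - dom p \<and> disjoint_family_on (node_witnesses P p) K"

definition LB :: "bf_mwsat \<Rightarrow> (nat \<rightharpoonup> nat) \<Rightarrow> nat set \<Rightarrow> ereal" where
  "LB P p K =
     ereal (\<Sum>j\<in>var_set P. cost P j * min_elem (node_domain P p j)) + (\<Sum>i\<in>K. delta P p i)"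

definition feasible_completion :: "bf_mwsat \<Rightarrow> (nat \<rightharpoonup> nat) \<Rightarrow> (nat \<Rightarrow> real) \<Rightarrow> bool" where
  "feasible_completion P p x \<longleftrightarrow>
     (\<exists>e. complete_assignment P e \<and> compatible P e \<and>
          (\<forall>i\<in>dom p. p i = Some (e i)) \<and> x \<in> complete_box P e)"

end

theory Submission imports Defs begin

text \<open>
  Fix a feasible completion \<open>x\<close> with complete witness assignment \<open>e\<close>. Every coordinate \<open>x j\<close>
  lies in the current domain \<open>D\<^sub>j(p)\<close>, so the slack \<open>c\<^sub>j (x j - min D\<^sub>j(p))\<close> is nonnegative, and
  the objective exceeds \<open>\<Sum>\<^sub>j c\<^sub>j min D\<^sub>j(p)\<close> by exactly the total slack over all variables.
  A row \<open>i\<close> of the packing is witnessed by its variable \<open>e i\<close>: since \<open>x (e i)\<close> lies in both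
  \<open>D\<^sub>e\<^sub>i(p)\<close> and the witness set of row \<open>i\<close>, the variable \<open>e i\<close> is one of the candidates in the
  minimum defining \<open>\<delta>\<^sub>i(p)\<close>, and its slack alone pays for \<open>\<delta>\<^sub>i(p)\<close>
  (lemma \<open>delta_le_slack\<close>). Disjointness of the candidate sets makes \<open>e\<close> injective on the
  packing, so no slack is charged twice and the sum of the \<open>\<delta>\<^sub>i(p)\<close> is at most the total slack.

  Continuity of the t-norm enters only through compactness of the domains, which guarantees that
  the minima exist and hence are lower bounds (lemma \<open>min_elem_le\<close>).
\<close>

lemma min_elem_le:
  assumes "compact S" and "z \<in> S"
  shows "min_elem S \<le> z"
proof -
  obtain s where "s \<in> S" and "\<forall>t\<in>S. s \<le> t"
    using compact_attains_inf[of S] assms by blast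
  hence "min_elem S = s"
    unfolding min_elem_def by (intro Least_equality) auto
  thus ?thesis
    using \<open>\<forall>t\<in>S. s \<le> t\<close> assms(2) by simp
qed

lemma continuous_on_q:
  assumes "is_bf_mwsat P" and "i \<in> row_set P" and "j \<in> var_set P"
  shows "continuous_on {0..1} (q P i j)"
proof -
  have cont: "continuous_on ({0..1} \<times> {0..1}) (\<lambda>(x, y). tnorm P x y)"
    and a: "a_pos P i j \<in> {0..1}" "a_neg P i j \<in> {0..1}"
    using assms by (auto simp: is_bf_mwsat_def continuous_t_norm_def)
  have "continuous_on {0..1} (\<lambda>z. tnorm P (a_pos P i j) z)"
    using a by (intro continuous_on_compose2[OF cont, of _ "\<lambda>z. (a_pos P i j, z)", simplified])
      (auto intro!: continuous_intros)
  moreover have "continuous_on {0..1} (\<lambda>z. tnorm P (a_neg P i j) (1 - z))"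
    using a by (intro continuous_on_compose2[OF cont, of _ "\<lambda>z. (a_neg P i j, 1 - z)", simplified])
      (auto intro!: continuous_intros)
  ultimately show ?thesis
    unfolding q_def by (intro continuous_on_max)
qed

lemma closed_I_cell:
  assumes "is_bf_mwsat P" and "i \<in> row_set P" and "j \<in> var_set P"
  shows "closed (I_cell P i j)"
proof -
  have "I_cell P i j = {0..1} \<inter> q P i j -` {..rhs P i}"
    by (auto simp: I_cell_def)
  thus ?thesis
    using continuous_closed_preimage[OF continuous_on_q[OF assms]] by simp
qed

lemma closed_S_cell:
  assumes "is_bf_mwsat P" and "i \<in> row_set P" and "j \<in> var_set P"
  shows "closed (S_cell P i j)"
proof -
  have "S_cell P i j = {0..1} \<inter> q P i j -` {rhs P i}"
    by (auto simp: S_cell_def)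
  thus ?thesis
    using continuous_closed_preimage[OF continuous_on_q[OF assms]] by simp
qed

lemma compact_I_var:
  assumes "is_bf_mwsat P" and "j \<in> var_set P"
  shows "compact (I_var P j)"
  unfolding I_var_def using assms
  by (intro compact_Int_closed closed_INT ballI closed_I_cell) auto

lemma closed_S'_cell:
  assumes "is_bf_mwsat P" and "i \<in> row_set P" and "j \<in> var_set P"
  shows "closed (S'_cell P i j)"
  unfolding S'_cell_def using assms
  by (intro closed_Int closed_S_cell compact_imp_closed compact_I_var)

lemma compact_node_domain:
  assumes "is_bf_mwsat P" and "dom p \<subseteq> row_set P" and "j \<in> var_set P"
  shows "compact (node_domain P p j)"
  unfolding node_domain_def using assms
  by (intro compact_Int_closed compact_I_var closed_INT ballI closed_S'_cell) auto

lemma complete_box_in_S'_cell: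
  assumes "complete_assignment P e" and "x \<in> complete_box P e" and "i \<in> row_set P"
  shows "x (e i) \<in> S'_cell P i (e i)"
proof -
  have "e i \<in> var_set P"
    using assms by (auto simp: complete_assignment_def witnesses_def)
  hence "x (e i) \<in> complete_domain P e (e i)"
    using assms(2) by (auto simp: complete_box_def)
  thus ?thesis
    using assms(3) by (auto simp: complete_domain_def split: if_splits)
qed

lemma complete_box_in_node_domain:
  assumes "complete_assignment P e" and "x \<in> complete_box P e"
    and "dom p \<subseteq> row_set P" and ext: "\<forall>i\<in>dom p. p i = Some (e i)"
    and "j \<in> var_set P"
  shows "x j \<in> node_domain P p j"
proof -
  have "x j \<in> complete_domain P e j"
    using assms by (auto simp: complete_box_def)
  hence "x j \<in> I_var P j"
    by (auto simp: complete_domain_def S'_cell_def split: if_splits)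
  moreover have "x j \<in> S'_cell P i j" if "p i = Some j" for i
  proof -
    have "i \<in> dom p" using that by blast
    hence "e i = j" and "i \<in> row_set P"
      using that ext assms(3) by auto
    thus ?thesis
      using complete_box_in_S'_cell[OF assms(1,2)] by blast
  qed
  ultimately show ?thesis
    by (auto simp: node_domain_def)
qed

text \<open>
  Any point \<open>z\<close> at which variable \<open>j\<close> may witness row \<open>i\<close> is at least the smallest such point, and
  the cost of moving \<open>j\<close> to that smallest point is one of the values minimized by \<open>\<delta>\<^sub>i(p)\<close>.
\<close>

lemma delta_le_slack:
  assumes "is_bf_mwsat P" and "dom p \<subseteq> row_set P" and "i \<in> row_set P"
    and "j \<in> witnesses P i" and z: "z \<in> node_domain P p j \<inter> S'_cell P i j"
  shows "delta P p i \<le> ereal (cost P j * (z - min_elem (node_domain P p j)))"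
proof -
  let ?f = "\<lambda>j. cost P j *
    (min_elem (node_domain P p j \<inter> S'_cell P i j) - min_elem (node_domain P p j))"
  have j: "j \<in> var_set P" and jw: "j \<in> node_witnesses P p i"
    using assms by (auto simp: witnesses_def node_witnesses_def)
  have "finite (node_witnesses P p i)"
    by (rule finite_subset[of _ "var_set P"])
      (auto simp: node_witnesses_def witnesses_def var_set_def)
  hence "Min (?f ` node_witnesses P p i) \<le> ?f j"
    using jw by (intro Min_le) auto
  also have "min_elem (node_domain P p j \<inter> S'_cell P i j) \<le> z"
    using assms j z
    by (intro min_elem_le compact_Int_closed compact_node_domain closed_S'_cell)
  hence "?f j \<le> cost P j * (z - min_elem (node_domain P p j))"
    using assms(1) j by (intro mult_left_mono) (auto simp: is_bf_mwsat_def)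
  finally show ?thesis
    using jw by (auto simp: delta_def)
qed

theorem proposition10:
  fixes P :: bf_mwsat
    and A :: "nat set"
    and p :: "nat \<rightharpoonup> nat"
    and K :: "nat set"
    and x :: "nat \<Rightarrow> real"
  assumes "is_bf_mwsat P"
    and "A \<subseteq> row_set P"
    and "search_node P A p"
    and "\<forall>j\<in>var_set P. node_domain P p j \<noteq> {}"
    and "disjoint_witness_packing P A p K"
    and "feasible_completion P p x"
  shows "LB P p K \<le> ereal (objective P x)"
proof -
  obtain e where e: "complete_assignment P e" "x \<in> complete_box P e"
    and ext: "\<forall>i\<in>dom p. p i = Some (e i)"
    using assms(6) by (auto simp: feasible_completion_def)
  have dom: "dom p \<subseteq> row_set P" and K: "K \<subseteq> row_set P"
    and disj: "disjoint_family_on (node_witnesses P p) K"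
    using assms(2,3,5) by (auto simp: search_node_def disjoint_witness_packing_def)
  define s where "s j = cost P j * (x j - min_elem (node_domain P p j))" for j
  have wit: "e i \<in> witnesses P i" "e i \<in> var_set P" if "i \<in> K" for i
    using that K e(1) by (auto simp: complete_assignment_def witnesses_def)
  have xD: "x j \<in> node_domain P p j" if "j \<in> var_set P" for j
    using complete_box_in_node_domain[OF e dom ext that] .
  have xS: "x (e i) \<in> node_domain P p (e i) \<inter> S'_cell P i (e i)" if "i \<in> K" for i
    using that K wit xD complete_box_in_S'_cell[OF e] by auto
  have s_nonneg: "0 \<le> s j" if "j \<in> var_set P" for j
    using that assms(1) min_elem_le[OF compact_node_domain[OF assms(1) dom that] xD[OF that]]
    by (auto simp: s_def is_bf_mwsat_def)
  have "inj_on e K"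
  proof (rule inj_onI, rule ccontr)
    fix r i assume "r \<in> K" "i \<in> K" "e r = e i" "r \<noteq> i"
    moreover have "e k \<in> node_witnesses P p k" if "k \<in> K" for k
      using wit(1)[OF that] xS[OF that] by (auto simp: node_witnesses_def)
    ultimately have "e i \<in> node_witnesses P p r \<inter> node_witnesses P p i"
      by (metis IntI)
    thus False
      using disj \<open>r \<in> K\<close> \<open>i \<in> K\<close> \<open>r \<noteq> i\<close> by (auto simp: disjoint_family_on_def)
  qed
  have "(\<Sum>i\<in>K. delta P p i) \<le> (\<Sum>i\<in>K. ereal (s (e i)))"
    unfolding s_def using assms(1) dom K wit(1) xS
    by (intro sum_mono delta_le_slack) auto
  also have "\<dots> = ereal (\<Sum>j\<in>e ` K. s j)"
    using \<open>inj_on e K\<close> by (simp add: sum.reindex)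
  also have "\<dots> \<le> ereal (\<Sum>j\<in>var_set P. s j)"
    using wit(2) s_nonneg by (auto intro!: sum_mono2 simp: var_set_def)
  finally have "LB P p K \<le> ereal (\<Sum>j\<in>var_set P. cost P j * min_elem (node_domain P p j))
      + ereal (\<Sum>j\<in>var_set P. s j)"
    unfolding LB_def by (intro add_left_mono)
  also have "\<dots> = ereal (objective P x)"
    by (simp add: objective_def s_def right_diff_distrib sum_subtractf)
  finally show ?thesis .
qed

end
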